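(* Let $L$ be a frame and let $X$ be its Priestley space of prime filters. The following are equivalent. (1) $L$ is subfit. (2) $\mathrm{cl}(\min U) = U$ for each $U \in \mathrm{ClopUp}(X)$. (3) $\min X$ is dense in $X$. (4) For each nuclear subset $N$ of $X$, $\min X \subseteq N$ implies $N = X$. (5) $\mathrm{cl}(\mathrm{sfit}\, U) = U$ for each $U \in \mathrm{ClopUp}(X)$.
   Context: A frame is a complete lattice satisfying $a \wedge \bigvee S = \bigvee\{a \wedge s \mid s \in S\}$. The Priestley space of a frame $L$ is the set $X$ of (proper) prime filters of $L$ ordered by inclusion, with topology generated by the basis $\{\sigma(a) \cap \sigma(b)^c \mid a,b \in L\}$, where $\sigma(a) = \{x \in X \mid a \in x\}$. The axiom of choice is assumed. $\mathrm{ClopUp}(X)$ is the set of clopen upsets of $X$; $\mathrm{cl}$ is topological closure in $X$; for $S \subseteq X$, $\min S$ is the set of minimal elements of $S$, and $\downarrow S=\{x \mid x \le s \text{ for some } s\in S\}$, $\downarrow x = \downarrow\{x\}$. A frame $L$ is subfit if for all $a,b\in L$ with $a \nleq b$ there is $c \in L$ with $a \vee c = 1$ and $b \vee c \neq 1$. A closed subset $N \subseteq X$ is a nuclear subset if $\downarrow(U \cap N)$ is clopen for each clopen $U \subseteq X$. For $U \in \mathrm{ClopUp}(X)$, the subfit kernel is $\mathrm{sfit}\, U = \{x \in U \mid \downarrow x \subseteq U\}$, where $\downarrow x$ is the principal downset of $x$ in $X$. Note: minimal elements and downsets are taken with respect to the inclusion order on prime filters. *)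

theory Defs
  imports "HOL-Analysis.Function_Topology"
begin

class frame = complete_lattice +
  assumes inf_Sup_frame: "inf a (Sup S) = Sup {inf a s | s. s \<in> S}"

definition subfit :: "'a::frame itself \<Rightarrow> bool" where
  "subfit L \<longleftrightarrow>
     (\<forall>a b :: 'a. \<not> a \<le> b \<longrightarrow> (\<exists>c. sup a c = top \<and> sup b c \<noteq> top))"

definition prime_filter :: "'a::bounded_lattice set \<Rightarrow> bool" where
  "prime_filter F \<longleftrightarrow>
     top \<in> F \<and>
     (\<forall>a b. a \<in> F \<longrightarrow> a \<le> b \<longrightarrow> b \<in> F) \<and>
     (\<forall>a b. a \<in> F \<longrightarrow> b \<in> F \<longrightarrow> inf a b \<in> F) \<and>
     bot \<notin> F \<and>
     (\<forall>a b. sup a b \<in> F \<longrightarrow> a \<in> F \<or> b \<in> F)"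

text \<open>
  The frame is the type \<open>'a\<close>. Its prime filters have type \<open>'a set\<close>, and the order on
  them is the subset relation.
\<close>

definition prime_filters :: "'a::frame set set" where
  "prime_filters = {x. prime_filter x}"

definition sigma_set :: "'a::frame \<Rightarrow> 'a set set" where
  "sigma_set a = {x \<in> prime_filters. a \<in> x}"

definition priestley_space :: "'a::frame set topology" where
  "priestley_space =
     topology_generated_by {sigma_set a \<inter> (prime_filters - sigma_set b) | a b. True}"

lemma topspace_priestley_space [simp]: "topspace priestley_space = prime_filters"
proof -
  have "sigma_set top \<inter> (prime_filters - sigma_set bot) = (prime_filters :: 'a set set)"
    by (auto simp: sigma_set_def prime_filters_def prime_filter_def)
  then have "(prime_filters :: 'a set set)
      \<in> {sigma_set a \<inter> (prime_filters - sigma_set b) | a b. True}"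
    by blast
  then show ?thesis
    unfolding priestley_space_def topology_generated_by_topspace
    by (auto simp: sigma_set_def)
qed

definition clopen_sets :: "'a::frame set set set" where
  "clopen_sets = {U. openin priestley_space U \<and> closedin priestley_space U}"

definition down :: "'a::frame set set \<Rightarrow> 'a set set" where
  "down S = {x \<in> prime_filters. \<exists>s\<in>S. x \<subseteq> s}"

definition clop_up :: "'a::frame set set set" where
  "clop_up = {U \<in> clopen_sets. \<forall>x\<in>U. \<forall>y\<in>prime_filters. x \<subseteq> y \<longrightarrow> y \<in> U}"

definition min_elements :: "'a set set \<Rightarrow> 'a set set" where
  "min_elements S = {x \<in> S. \<forall>y\<in>S. y \<subseteq> x \<longrightarrow> y = x}"

definition nuclear_subset :: "'a::frame set set \<Rightarrow> bool" where
  "nuclear_subset N \<longleftrightarrow>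
     closedin priestley_space N \<and> (\<forall>U\<in>clopen_sets. down (U \<inter> N) \<in> clopen_sets)"

definition sfit :: "'a::frame set set \<Rightarrow> 'a set set" where
  "sfit U = {x \<in> U. down {x} \<subseteq> U}"

end

theory Submission
  imports Defs
begin

text \<open>
  All five conditions are compared with density of the set of minimal prime filters. Since the sets
  \<open>sigma_set a - sigma_set b\<close> form a basis, and are nonempty exactly when \<open>\<not> a \<le> b\<close>, density says
  that whenever \<open>\<not> a \<le> b\<close> some minimal prime filter contains \<open>a\<close> and omits \<open>b\<close>
  (\<open>dense_iff_separates\<close>).

  Complements of minimal prime filters are maximal ideals. Hence an element \<open>a\<close> of a minimal prime
  filter \<open>x\<close> satisfies \<open>sup a d = top\<close> for some \<open>d \<notin> x\<close> (\<open>minimal_prime_cover\<close>), and every proper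
  element is omitted by some minimal prime filter (\<open>minimal_prime_omitting\<close>). These two facts
  translate separation by minimal prime filters into subfitness and back (\<open>subfit_iff_min_dense\<close>).

  A minimal prime filter lying in a clopen upset \<open>U\<close> belongs to both \<open>min_elements U\<close> and \<open>sfit U\<close>,
  and a dense set stays dense in every open subspace; so density gives the conditions on
  \<open>min_elements U\<close> and \<open>sfit U\<close>. Conversely, \<open>U = prime_filters\<close> recovers density from the former. For the
  latter, a point of \<open>sfit (sigma_set a)\<close> omitting \<open>b\<close> lies above a minimal prime filter, which omits
  \<open>b\<close> and still contains \<open>a\<close> by the definition of the kernel.

  For nuclear subsets, the point is that every clopen set is nuclear (\<open>clopen_nuclear\<close>). This is
  where the frame structure enters: Heyting implication yields that downsets of clopen sets are
  clopen, once compactness has reduced clopen sets to finite unions of basic ones. If the minimal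
  prime filters were not dense, the complement of a nonempty basic set avoiding all of them would
  be a proper nuclear subset containing them.
\<close>

section \<open>Separation by prime filters\<close>

lemma inf_sup_frame: "inf a (sup b c) = sup (inf a b) (inf a (c::'a::frame))"
proof -
  have "{inf a s |s. s \<in> {b, c}} = {inf a b, inf a c}" by auto
  then show ?thesis using inf_Sup_frame[of a "{b, c}"] by simp
qed

lemma sup_inf_frame: "sup a (inf b c) = inf (sup a b) (sup a (c::'a::frame))"
proof -
  have "inf (sup a b) (sup a c) = sup (inf (sup a b) a) (inf (sup a b) c)"
    by (rule inf_sup_frame)
  also have "\<dots> = sup a (sup (inf c a) (inf c b))"
    by (simp add: inf_commute inf_sup_frame)
  also have "\<dots> = sup a (inf b c)"
    by (simp add: sup_assoc[symmetric] sup_absorb1 inf_commute)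
  finally show ?thesis by simp
qed

definition lattice_ideal :: "'a::bounded_lattice set \<Rightarrow> bool" where
  "lattice_ideal I \<longleftrightarrow> bot \<in> I \<and> (\<forall>a b. b \<in> I \<longrightarrow> a \<le> b \<longrightarrow> a \<in> I) \<and>
     (\<forall>a b. a \<in> I \<longrightarrow> b \<in> I \<longrightarrow> sup a b \<in> I)"

definition lattice_filter :: "'a::bounded_lattice set \<Rightarrow> bool" where
  "lattice_filter F \<longleftrightarrow> top \<in> F \<and> (\<forall>a b. a \<in> F \<longrightarrow> a \<le> b \<longrightarrow> b \<in> F) \<and>
     (\<forall>a b. a \<in> F \<longrightarrow> b \<in> F \<longrightarrow> inf a b \<in> F)"

lemma lattice_idealI:
  assumes "bot \<in> I" "\<And>a b. b \<in> I \<Longrightarrow> a \<le> b \<Longrightarrow> a \<in> I"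
    "\<And>a b. a \<in> I \<Longrightarrow> b \<in> I \<Longrightarrow> sup a b \<in> I"
  shows "lattice_ideal I"
  using assms unfolding lattice_ideal_def by blast

lemma lattice_filterI:
  assumes "top \<in> F" "\<And>a b. a \<in> F \<Longrightarrow> a \<le> b \<Longrightarrow> b \<in> F"
    "\<And>a b. a \<in> F \<Longrightarrow> b \<in> F \<Longrightarrow> inf a b \<in> F"
  shows "lattice_filter F"
  using assms unfolding lattice_filter_def by blast

lemma lattice_ideal_bot: "lattice_ideal I \<Longrightarrow> bot \<in> I"
  and lattice_ideal_mono: "lattice_ideal I \<Longrightarrow> b \<in> I \<Longrightarrow> a \<le> b \<Longrightarrow> a \<in> I"
  and lattice_ideal_sup: "lattice_ideal I \<Longrightarrow> a \<in> I \<Longrightarrow> b \<in> I \<Longrightarrow> sup a b \<in> I"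
  unfolding lattice_ideal_def by blast+

lemma lattice_filter_top: "lattice_filter F \<Longrightarrow> top \<in> F"
  and lattice_filter_mono: "lattice_filter F \<Longrightarrow> a \<in> F \<Longrightarrow> a \<le> b \<Longrightarrow> b \<in> F"
  and lattice_filter_inf: "lattice_filter F \<Longrightarrow> a \<in> F \<Longrightarrow> b \<in> F \<Longrightarrow> inf a b \<in> F"
  unfolding lattice_filter_def by blast+

lemma prime_filter_iff:
  "prime_filter x \<longleftrightarrow> lattice_filter x \<and> lattice_ideal (- x)"
  unfolding prime_filter_def lattice_filter_def lattice_ideal_def
  by blast

lemma prime_filtersD:
  assumes "x \<in> prime_filters"
  shows "lattice_filter x" "lattice_ideal (- x)"
  using assms unfolding prime_filters_def prime_filter_iff by auto

lemma lattice_filter_top_singleton: "lattice_filter {top}"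
  by (rule lattice_filterI) (auto simp: top_unique)

lemma lattice_ideal_atMost: "lattice_ideal {..b}"
  by (rule lattice_idealI) (auto intro: order_trans)

lemma lattice_ideal_adjoin:
  assumes "lattice_ideal I"
  shows "lattice_ideal {z. \<exists>d\<in>I. z \<le> sup d a}"
proof (rule lattice_idealI)
  show "bot \<in> {z. \<exists>d\<in>I. z \<le> sup d a}" using lattice_ideal_bot[OF assms] by auto
next
  fix u v assume "u \<in> {z. \<exists>d\<in>I. z \<le> sup d a}" "v \<in> {z. \<exists>d\<in>I. z \<le> sup d a}"
  then obtain d e where de: "d \<in> I" "e \<in> I" "u \<le> sup d a" "v \<le> sup e a" by auto
  have "sup u v \<le> sup (sup d e) a"
    using sup_mono[OF de(3,4)] by (simp only: sup_aci)
  then show "sup u v \<in> {z. \<exists>d\<in>I. z \<le> sup d a}"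
    using lattice_ideal_sup[OF assms de(1,2)] by blast
qed (auto intro: order_trans)

lemma lattice_filter_adjoin:
  assumes "lattice_filter F"
  shows "lattice_filter {z. \<exists>c\<in>F. inf c a \<le> z}"
proof (rule lattice_filterI)
  show "top \<in> {z. \<exists>c\<in>F. inf c a \<le> z}" using lattice_filter_top[OF assms] by auto
next
  fix u v assume "u \<in> {z. \<exists>c\<in>F. inf c a \<le> z}" "v \<in> {z. \<exists>c\<in>F. inf c a \<le> z}"
  then obtain d e where de: "d \<in> F" "e \<in> F" "inf d a \<le> u" "inf e a \<le> v" by auto
  have "inf (inf d e) a \<le> inf u v"
    using inf_mono[OF de(3,4)] by (simp only: inf_aci)
  then show "inf u v \<in> {z. \<exists>c\<in>F. inf c a \<le> z}"
    using lattice_filter_inf[OF assms de(1,2)] by blast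
qed (auto intro: order_trans)

text \<open>
  An ideal maximal among those extending \<open>I\<close> and disjoint from \<open>F\<close> has a prime complement by
  distributivity. Maximality of the ideal is also minimality of its complement, which provides
  separating prime filters and minimal prime filters at once.
\<close>

lemma minimal_prime_filter_separation:
  fixes F I :: "'a::frame set"
  assumes F: "lattice_filter F" and I: "lattice_ideal I" and disj: "I \<inter> F = {}"
  obtains x where "x \<in> prime_filters" "F \<subseteq> x" "I \<inter> x = {}"
    "\<And>y. y \<in> prime_filters \<Longrightarrow> F \<subseteq> y \<Longrightarrow> y \<subseteq> x \<Longrightarrow> y = x"
proof -
  define A where "A = {J. lattice_ideal J \<and> I \<subseteq> J \<and> J \<inter> F = {}}"
  have "\<exists>M\<in>A. \<forall>X\<in>A. M \<subseteq> X \<longrightarrow> X = M"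
  proof (rule subset_Zorn_nonempty)
    show "A \<noteq> {}" using I disj unfolding A_def by auto
  next
    fix C assume "C \<noteq> {}" and chain: "subset.chain A C"
    then have CA: "\<And>J. J \<in> C \<Longrightarrow> lattice_ideal J \<and> I \<subseteq> J \<and> J \<inter> F = {}"
      and lin: "\<And>J K. J \<in> C \<Longrightarrow> K \<in> C \<Longrightarrow> J \<subseteq> K \<or> K \<subseteq> J"
      unfolding subset_chain_def A_def by auto
    have "lattice_ideal (\<Union>C)"
    proof (rule lattice_idealI)
      show "bot \<in> \<Union>C" using \<open>C \<noteq> {}\<close> CA lattice_ideal_bot by blast
    next
      fix a b assume "b \<in> \<Union>C" "a \<le> b"
      then show "a \<in> \<Union>C" using CA lattice_ideal_mono by blast
    next
      fix a b assume "a \<in> \<Union>C" "b \<in> \<Union>C"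
      then obtain J K where "J \<in> C" "K \<in> C" "a \<in> J" "b \<in> K" by blast
      with lin[of J K] obtain M where "M \<in> C" "a \<in> M" "b \<in> M" by blast
      then show "sup a b \<in> \<Union>C" using CA lattice_ideal_sup by blast
    qed
    moreover have "I \<subseteq> \<Union>C" "\<Union>C \<inter> F = {}" using \<open>C \<noteq> {}\<close> CA by blast+
    ultimately show "\<Union>C \<in> A" unfolding A_def by blast
  qed
  then obtain J where JA: "J \<in> A" and maxA: "\<And>K. K \<in> A \<Longrightarrow> J \<subseteq> K \<Longrightarrow> K = J"
    by blast
  from JA have J: "lattice_ideal J" "I \<subseteq> J" "J \<inter> F = {}"
    unfolding A_def by auto
  have max: "K = J" if "lattice_ideal K" "I \<subseteq> K" "K \<inter> F = {}" "J \<subseteq> K" for K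
    using maxA[of K] that unfolding A_def by simp
  have meets: "\<exists>d\<in>J. sup d a \<in> F" if "a \<notin> J" for a
  proof (rule ccontr)
    assume no: "\<not> (\<exists>d\<in>J. sup d a \<in> F)"
    let ?K = "{z. \<exists>d\<in>J. z \<le> sup d a}"
    have sub: "J \<subseteq> ?K" by (auto intro: le_supI1)
    have "?K \<inter> F = {}" using no lattice_filter_mono[OF F] by blast
    then have "?K = J"
      using max lattice_ideal_adjoin[OF J(1)] J(2) sub by blast
    moreover have "a \<in> ?K" using lattice_ideal_bot[OF J(1)] by auto
    ultimately show False using that by simp
  qed
  have "lattice_filter (- J)"
  proof (rule lattice_filterI)
    show "top \<in> - J" using J(3) lattice_filter_top[OF F] by blast
  next
    fix a b assume "a \<in> - J" "a \<le> b"
    then show "b \<in> - J" using lattice_ideal_mono[OF J(1)] by blast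
  next
    fix a b assume "a \<in> - J" "b \<in> - J"
    then obtain d e where de: "d \<in> J" "e \<in> J" "sup d a \<in> F" "sup e b \<in> F"
      using meets by blast
    have "sup (sup d e) a \<in> F"
      by (rule lattice_filter_mono[OF F de(3)]) (auto intro: le_supI1 le_supI2)
    moreover have "sup (sup d e) b \<in> F"
      by (rule lattice_filter_mono[OF F de(4)]) (auto intro: le_supI1 le_supI2)
    ultimately have "sup (sup d e) (inf a b) \<in> F"
      using lattice_filter_inf[OF F] by (simp add: sup_inf_frame)
    then show "inf a b \<in> - J" using lattice_ideal_sup[OF J(1)] de(1,2) J(3) by blast
  qed
  then have prime: "- J \<in> prime_filters"
    using J(1) unfolding prime_filters_def prime_filter_iff by simp
  show thesis
  proof (rule that[OF prime])
    show "F \<subseteq> - J" "I \<inter> - J = {}" using J by blast+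
  next
    fix y assume y: "y \<in> prime_filters" "F \<subseteq> y" "y \<subseteq> - J"
    then have "- y = J" using max[of "- y"] prime_filtersD(2)[OF y(1)] J(2) by blast
    then show "y = - J" by blast
  qed
qed

corollary prime_filter_separation:
  fixes F I :: "'a::frame set"
  assumes "lattice_filter F" "lattice_ideal I" "I \<inter> F = {}"
  obtains x where "x \<in> prime_filters" "F \<subseteq> x" "I \<inter> x = {}"
  by (rule minimal_prime_filter_separation[OF assms])

lemma prime_filter_separates:
  assumes "\<not> a \<le> (b::'a::frame)"
  obtains x where "x \<in> prime_filters" "a \<in> x" "b \<notin> x"
proof -
  have "lattice_filter {a..}"
    by (rule lattice_filterI) (auto intro: order_trans)
  moreover have "{..b} \<inter> {a..} = {}" using assms by (auto intro: order_trans)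
  ultimately obtain x where "x \<in> prime_filters" "{a..} \<subseteq> x" "{..b} \<inter> x = {}"
    using prime_filter_separation lattice_ideal_atMost by metis
  then show thesis using that by auto
qed

section \<open>Minimal prime filters\<close>

lemma min_prime_below:
  fixes I :: "'a::frame set"
  assumes "lattice_ideal I" "top \<notin> I"
  obtains x where "x \<in> min_elements prime_filters" "I \<inter> x = {}"
proof (rule minimal_prime_filter_separation[OF lattice_filter_top_singleton assms(1)])
  show "I \<inter> {top} = {}" using assms(2) by simp
next
  fix x :: "'a set"
  assume x: "x \<in> prime_filters" "I \<inter> x = {}"
    and min: "\<And>y. y \<in> prime_filters \<Longrightarrow> {top} \<subseteq> y \<Longrightarrow> y \<subseteq> x \<Longrightarrow> y = x"
  have "y = x" if "y \<in> prime_filters" "y \<subseteq> x" for y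
    using min[OF that(1) _ that(2)] lattice_filter_top[OF prime_filtersD(1)[OF that(1)]] by simp
  then have "x \<in> min_elements prime_filters"
    unfolding min_elements_def using x(1) by simp
  then show thesis using that x(2) by blast
qed

lemma minimal_prime_omitting:
  assumes "(b::'a::frame) \<noteq> top"
  obtains x where "x \<in> min_elements prime_filters" "b \<notin> x"
proof -
  have "top \<notin> {..b}" using assms by (simp add: top_unique)
  then obtain x where "x \<in> min_elements prime_filters" "{..b} \<inter> x = {}"
    using min_prime_below[OF lattice_ideal_atMost] by blast
  then show thesis using that by auto
qed

lemma minimal_prime_below_prime:
  assumes "y \<in> prime_filters"
  obtains x where "x \<in> min_elements prime_filters" "x \<subseteq> y"
proof -
  have "top \<notin> - y" using lattice_filter_top[OF prime_filtersD(1)[OF assms]] by simp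
  then obtain x where "x \<in> min_elements prime_filters" "- y \<inter> x = {}"
    using min_prime_below[OF prime_filtersD(2)[OF assms]] by blast
  then show thesis using that by blast
qed

text \<open>
  If no such \<open>d\<close> existed, the complement of \<open>x\<close> together with \<open>a\<close> would generate a proper ideal,
  and a prime filter omitting that ideal would lie strictly below \<open>x\<close>.
\<close>

lemma minimal_prime_cover:
  assumes x: "x \<in> min_elements prime_filters" and a: "(a::'a::frame) \<in> x"
  obtains d where "d \<notin> x" "sup a d = top"
proof (rule ccontr)
  assume "\<not> thesis"
  then have no: "\<And>d. d \<notin> x \<Longrightarrow> sup d a \<noteq> top" using that by (auto simp: sup_commute)
  have xp: "x \<in> prime_filters" using x unfolding min_elements_def by simp
  let ?K = "{z. \<exists>d\<in>- x. z \<le> sup d a}"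
  have "top \<notin> ?K" using no by (auto simp: top_unique)
  then obtain y where y: "y \<in> min_elements prime_filters" "?K \<inter> y = {}"
    using min_prime_below[OF lattice_ideal_adjoin[OF prime_filtersD(2)[OF xp]]] by blast
  have "y \<subseteq> x" using y(2) by (auto intro: le_supI1)
  then have "y = x" using x y(1) unfolding min_elements_def by blast
  moreover have "a \<in> ?K" using lattice_ideal_bot[OF prime_filtersD(2)[OF xp]] by auto
  ultimately show False using a y(2) by blast
qed

section \<open>The topology: basis, compactness, clopen sets\<close>

lemma sigma_set_subset: "sigma_set a \<subseteq> prime_filters"
  by (auto simp: sigma_set_def)

lemma sigma_set_inf: "sigma_set (inf a b) = sigma_set a \<inter> sigma_set b"
proof -
  have "inf a b \<in> x \<longleftrightarrow> a \<in> x \<and> b \<in> x" if "x \<in> prime_filters" for x :: "'a set"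
    using prime_filtersD(1)[OF that] lattice_filter_mono[of x] lattice_filter_inf[of x a b]
      inf_le1[of a b] inf_le2[of a b] by blast
  then show ?thesis unfolding sigma_set_def by auto
qed

lemma sigma_set_sup: "sigma_set (sup a b) = sigma_set a \<union> sigma_set b"
proof -
  have "sup a b \<in> x \<longleftrightarrow> a \<in> x \<or> b \<in> x" if "x \<in> prime_filters" for x :: "'a set"
    using prime_filtersD[OF that] lattice_filter_mono[of x] lattice_ideal_sup[of "- x" a b]
      sup_ge1[of a b] sup_ge2[of b a] by blast
  then show ?thesis unfolding sigma_set_def by auto
qed

lemma sigma_set_top: "sigma_set top = prime_filters"
  unfolding sigma_set_def using prime_filtersD(1) lattice_filter_top by blast

lemma sigma_set_bot: "sigma_set bot = {}"
  unfolding sigma_set_def using prime_filtersD(2) lattice_ideal_bot by blast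

lemma openin_basic: "openin priestley_space (sigma_set a - sigma_set b)"
proof -
  have "sigma_set a - sigma_set b = sigma_set a \<inter> (prime_filters - sigma_set b)"
    using sigma_set_subset by blast
  then show ?thesis
    unfolding priestley_space_def by (intro topology_generated_by_Basis) blast
qed

lemma clopen_Diff: "U \<in> clopen_sets \<Longrightarrow> V \<in> clopen_sets \<Longrightarrow> U - V \<in> clopen_sets"
  unfolding clopen_sets_def by auto

lemma clopen_UN:
  "finite K \<Longrightarrow> (\<And>k. k \<in> K \<Longrightarrow> f k \<in> clopen_sets) \<Longrightarrow> (\<Union>k\<in>K. f k) \<in> clopen_sets"
  unfolding clopen_sets_def by (auto intro!: closedin_Union)

lemma clopen_prime_filters: "prime_filters \<in> clopen_sets"
  unfolding clopen_sets_def
  using openin_topspace[of priestley_space] closedin_topspace[of priestley_space] by simp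

lemma clopen_sigma_set: "sigma_set a \<in> clopen_sets"
  unfolding clopen_sets_def closedin_def
  using openin_basic[of a bot] openin_basic[of top a]
  by (simp add: sigma_set_bot sigma_set_top sigma_set_subset)

lemma clopen_basic: "sigma_set a - sigma_set b \<in> clopen_sets"
  by (intro clopen_Diff clopen_sigma_set)

lemma openin_contains_basic:
  assumes "openin priestley_space U" "x \<in> U"
  obtains a b where "x \<in> sigma_set a - sigma_set b" "sigma_set a - sigma_set b \<subseteq> U"
proof -
  have "generate_topology_on {sigma_set a \<inter> (prime_filters - sigma_set b) | a b. True} U"
    using assms(1) unfolding priestley_space_def openin_topology_generated_by_iff .
  then have "\<exists>a b. x \<in> sigma_set a - sigma_set b \<and> sigma_set a - sigma_set b \<subseteq> U"
    using assms(2)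
  proof (induction arbitrary: x)
    case (Int U V)
    then obtain a b a' b' where
      "x \<in> sigma_set a - sigma_set b" "sigma_set a - sigma_set b \<subseteq> U"
      "x \<in> sigma_set a' - sigma_set b'" "sigma_set a' - sigma_set b' \<subseteq> V"
      by (metis IntD1 IntD2)
    then have "x \<in> sigma_set (inf a a') - sigma_set (sup b b')
        \<and> sigma_set (inf a a') - sigma_set (sup b b') \<subseteq> U \<inter> V"
      by (auto simp: sigma_set_inf sigma_set_sup)
    then show ?case by blast
  next
    case (UN K)
    then show ?case by (meson Union_iff Union_upper order_trans)
  next
    case (Basis U)
    then obtain a b where "U = sigma_set a \<inter> (prime_filters - sigma_set b)" by auto
    then have "x \<in> sigma_set a - sigma_set b \<and> sigma_set a - sigma_set b \<subseteq> U"
      using Basis.prems by (auto simp: sigma_set_def)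
    then show ?case by blast
  qed simp
  then show thesis using that by blast
qed

text \<open>
  By the Alexander subbase theorem it suffices to treat covers by sets \<open>sigma_set a\<close> and
  \<open>prime_filters - sigma_set b\<close>. In such a cover the filter generated by the \<open>b\<close> and the ideal
  generated by the \<open>a\<close> must meet, as otherwise a separating prime filter would be uncovered; one
  common element involves only finitely many \<open>a\<close> and \<open>b\<close>.
\<close>

lemma compact_priestley_space: "compact_space (priestley_space :: 'a::frame set topology)"
proof -
  define S :: "'a set set set" where
    "S = range sigma_set \<union> range (\<lambda>b. prime_filters - sigma_set b)"
  define T where "T = topology (arbitrary union_of (finite intersection_of (\<lambda>x. x \<in> S) relative_to \<Union>S))"
  have US: "\<Union>S = prime_filters"
    unfolding S_def using sigma_set_subset sigma_set_top by blast
  have top: "topspace T = prime_filters"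
    unfolding T_def topspace_subbase US ..
  have "compact_space T"
  proof (rule Alexander_subbase[OF T_def[symmetric]])
    fix C assume C: "C \<subseteq> S" and cov: "\<Union>C = topspace T"
    define A where "A = {a. sigma_set a \<in> C}"
    define B where "B = {b. prime_filters - sigma_set b \<in> C}"
    define I where "I = {z. \<exists>A'. finite A' \<and> A' \<subseteq> A \<and> z \<le> Sup A'}"
    define F where "F = {z. \<exists>B'. finite B' \<and> B' \<subseteq> B \<and> Inf B' \<le> z}"
    have I: "lattice_ideal I"
    proof (rule lattice_idealI)
      show "bot \<in> I" unfolding I_def by (auto intro: exI[of _ "{}"])
    next
      fix u v assume "u \<in> I" "v \<in> I"
      then obtain P Q where "finite P" "P \<subseteq> A" "u \<le> Sup P" "finite Q" "Q \<subseteq> A" "v \<le> Sup Q"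
        unfolding I_def by blast
      then show "sup u v \<in> I"
        unfolding I_def by (intro CollectI exI[of _ "P \<union> Q"])
          (auto simp: Sup_union_distrib intro: le_supI1 le_supI2)
    qed (auto simp: I_def intro: order_trans)
    have F: "lattice_filter F"
    proof (rule lattice_filterI)
      show "top \<in> F" unfolding F_def by (auto intro: exI[of _ "{}"])
    next
      fix u v assume "u \<in> F" "v \<in> F"
      then obtain P Q where "finite P" "P \<subseteq> B" "Inf P \<le> u" "finite Q" "Q \<subseteq> B" "Inf Q \<le> v"
        unfolding F_def by blast
      then show "inf u v \<in> F"
        unfolding F_def by (intro CollectI exI[of _ "P \<union> Q"])
          (auto simp: Inf_union_distrib intro: le_infI1 le_infI2)
    qed (auto simp: F_def intro: order_trans)
    have "I \<inter> F \<noteq> {}"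
    proof
      assume "I \<inter> F = {}"
      then obtain x where x: "x \<in> prime_filters" "F \<subseteq> x" "I \<inter> x = {}"
        using prime_filter_separation[OF F I] by blast
      obtain c where c: "c \<in> C" "x \<in> c" using x(1) cov top by blast
      from C c(1) consider a where "c = sigma_set a" | b where "c = prime_filters - sigma_set b"
        unfolding S_def by blast
      then show False
      proof cases
        case 1
        then have "a \<in> I" using c(1) unfolding I_def A_def by (auto intro!: exI[of _ "{a}"])
        then show False using 1 c(2) x(3) unfolding sigma_set_def by blast
      next
        case 2
        then have "b \<in> F" using c(1) unfolding F_def B_def by (auto intro!: exI[of _ "{b}"])
        then show False using 2 c(2) x(2) unfolding sigma_set_def by blast
      qed
    qed
    then obtain A' B' where A': "finite A'" "A' \<subseteq> A" and B': "finite B'" "B' \<subseteq> B"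
      and le: "Inf B' \<le> Sup A'"
      unfolding I_def F_def by (blast intro: order_trans)
    define C' where "C' = sigma_set ` A' \<union> (\<lambda>b. prime_filters - sigma_set b) ` B'"
    have "topspace T \<subseteq> \<Union>C'"
    proof
      fix x assume "x \<in> topspace T"
      then have x: "x \<in> prime_filters" using top by simp
      note xF = prime_filtersD(1)[OF x] and xI = prime_filtersD(2)[OF x]
      have "Inf B' \<in> x" if "B' \<subseteq> x"
        using B'(1) that
        by (induction B') (auto intro: lattice_filter_top[OF xF] lattice_filter_inf[OF xF])
      moreover have "Sup A' \<notin> x" if "A' \<inter> x = {}"
        using A'(1) that
        by (induction A') (use lattice_ideal_bot[OF xI] lattice_ideal_sup[OF xI] in auto)
      ultimately have "\<not> B' \<subseteq> x \<or> A' \<inter> x \<noteq> {}"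
        using lattice_filter_mono[OF xF _ le] by blast
      then show "x \<in> \<Union>C'" using x unfolding C'_def sigma_set_def by blast
    qed
    moreover have C'C: "C' \<subseteq> C" using A'(2) B'(2) unfolding C'_def A_def B_def by blast
    ultimately have "\<Union>C' = topspace T"
      using Union_mono[OF C'C] unfolding cov by (simp add: subset_antisym)
    moreover have "finite C'" using A'(1) B'(1) unfolding C'_def by simp
    ultimately show "\<exists>C'. finite C' \<and> C' \<subseteq> C \<and> \<Union>C' = topspace T"
      using C'C by (intro exI[of _ C']) simp
  qed
  moreover have "openin T U" if "openin priestley_space U" for U
  proof -
    have sub: "openin T s" if "s \<in> S" for s
    proof -
      have "(finite intersection_of (\<lambda>x. x \<in> S) relative_to \<Union>S) s"
        using that by (auto simp: relative_to_def intro!: exI[of _ s] finite_intersection_of_inc)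
      then show ?thesis
        unfolding T_def openin_subbase by (rule arbitrary_union_of_inc)
    qed
    have "openin T (sigma_set a - sigma_set b)" for a b
    proof -
      have "sigma_set a - sigma_set b = sigma_set a \<inter> (prime_filters - sigma_set b)"
        using sigma_set_subset by blast
      moreover have "openin T (sigma_set a \<inter> (prime_filters - sigma_set b))"
        by (intro openin_Int sub) (auto simp: S_def)
      ultimately show ?thesis by simp
    qed
    then show ?thesis
      by (subst openin_subopen) (meson openin_contains_basic that)
  qed
  ultimately show ?thesis
    unfolding compact_space_alt top topspace_priestley_space by blast
qed

lemma clopen_finite_union_basic:
  fixes U :: "'a::frame set set"
  assumes "U \<in> clopen_sets"
  obtains K where "finite K" "U = (\<Union>(a, b)\<in>K. sigma_set a - sigma_set b)"
proof -
  have op: "openin priestley_space U" and "compactin priestley_space U"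
    using assms closedin_compact_space[OF compact_priestley_space]
    unfolding clopen_sets_def by auto
  define B :: "('a \<times> 'a) set" where "B = {(a, b). sigma_set a - sigma_set b \<subseteq> U}"
  define f :: "'a \<times> 'a \<Rightarrow> 'a set set" where "f = (\<lambda>(a, b). sigma_set a - sigma_set b)"
  have "U \<subseteq> \<Union>(f ` B)"
  proof
    fix x assume "x \<in> U"
    then obtain a b where ab: "x \<in> sigma_set a - sigma_set b" "sigma_set a - sigma_set b \<subseteq> U"
      using openin_contains_basic[OF op] by blast
    then have "(a, b) \<in> B" "x \<in> f (a, b)" unfolding B_def f_def by simp_all
    then show "x \<in> \<Union>(f ` B)" by blast
  qed
  moreover have "\<forall>V\<in>f ` B. openin priestley_space V"
    unfolding f_def using openin_basic by auto
  ultimately obtain G where G: "finite G" "G \<subseteq> f ` B" "U \<subseteq> \<Union>G"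
    using \<open>compactin priestley_space U\<close> unfolding compactin_def by meson
  then obtain K where K: "finite K" "K \<subseteq> B" "G = f ` K"
    using finite_subset_image by metis
  have "f k \<subseteq> U" if "k \<in> B" for k using that unfolding B_def f_def by auto
  then have "U = (\<Union>k\<in>K. f k)" using G(3) K(2,3) by blast
  then show thesis using that[OF K(1)] unfolding f_def by simp
qed

section \<open>Downsets of clopen sets and nuclear subsets\<close>

text \<open>
  The element \<open>Sup {c. inf c a \<le> b}\<close> is the Heyting implication of \<open>a\<close> and \<open>b\<close>. A prime filter omits
  it exactly when it extends to a prime filter containing \<open>a\<close> but not \<open>b\<close>.
\<close>

lemma down_basic:
  "down (sigma_set a - sigma_set b) = prime_filters - sigma_set (Sup {c. inf c a \<le> (b::'a::frame)})"
    (is "_ = _ - sigma_set ?i")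
proof -
  have "inf a ?i \<le> b"
    unfolding inf_Sup_frame by (rule Sup_least) (auto simp: inf_commute)
  have "(\<exists>y\<in>sigma_set a - sigma_set b. x \<subseteq> y) \<longleftrightarrow> ?i \<notin> x" if x: "x \<in> prime_filters" for x
  proof
    assume "\<exists>y\<in>sigma_set a - sigma_set b. x \<subseteq> y"
    then obtain y where y: "y \<in> prime_filters" "a \<in> y" "b \<notin> y" "x \<subseteq> y"
      unfolding sigma_set_def by blast
    note yF = prime_filtersD(1)[OF y(1)]
    show "?i \<notin> x"
      using y lattice_filter_inf[OF yF y(2)] lattice_filter_mono[OF yF _ \<open>inf a ?i \<le> b\<close>] by blast
  next
    assume i: "?i \<notin> x"
    note xF = prime_filtersD(1)[OF x]
    let ?F = "{z. \<exists>c\<in>x. inf c a \<le> z}"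
    have "\<not> inf c a \<le> b" if "c \<in> x" for c
    proof
      assume "inf c a \<le> b"
      then have "c \<le> ?i" by (simp add: Sup_upper)
      then show False using i lattice_filter_mono[OF xF that] by blast
    qed
    then have "{..b} \<inter> ?F = {}" by (auto dest: order_trans)
    then obtain y where y: "y \<in> prime_filters" "?F \<subseteq> y" "{..b} \<inter> y = {}"
      using prime_filter_separation[OF lattice_filter_adjoin[OF xF] lattice_ideal_atMost] by blast
    have "a \<in> ?F" using lattice_filter_top[OF xF] by auto
    then have "a \<in> y" by (rule subsetD[OF y(2)])
    moreover have "b \<notin> y" using y(3) by auto
    ultimately have "y \<in> sigma_set a - sigma_set b" using y(1) by (simp add: sigma_set_def)
    moreover have "x \<subseteq> ?F" by (auto intro: le_infI1)
    ultimately show "\<exists>y\<in>sigma_set a - sigma_set b. x \<subseteq> y"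
      using subset_trans[OF _ y(2)] by blast
  qed
  then show ?thesis unfolding down_def by (auto simp: sigma_set_def)
qed

text \<open>
  Downsets commute with unions, so compactness reduces the claim to basic sets.
\<close>

lemma down_clopen:
  assumes "U \<in> clopen_sets"
  shows "down U \<in> clopen_sets"
proof -
  obtain K where K: "finite K" "U = (\<Union>(a, b)\<in>K. sigma_set a - sigma_set b)"
    using clopen_finite_union_basic[OF assms] .
  have "down U = (\<Union>(a, b)\<in>K. down (sigma_set a - sigma_set b))"
    unfolding K(2) down_def by auto
  also have "\<dots> \<in> clopen_sets"
    using K(1) by (intro clopen_UN)
      (auto simp: down_basic intro: clopen_Diff clopen_prime_filters clopen_sigma_set)
  finally show ?thesis .
qed

lemma clopen_nuclear:
  assumes "N \<in> clopen_sets"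
  shows "nuclear_subset N"
  unfolding nuclear_subset_def
proof (intro conjI ballI)
  show "closedin priestley_space N" using assms by (simp add: clopen_sets_def)
  fix U :: "'a set set" assume "U \<in> clopen_sets"
  with assms have "U \<inter> N \<in> clopen_sets" by (auto simp: clopen_sets_def)
  then show "down (U \<inter> N) \<in> clopen_sets" by (rule down_clopen)
qed

section \<open>Density of the minimal prime filters\<close>

lemma dense_iff_separates:
  assumes "S \<subseteq> (prime_filters :: 'a::frame set set)"
  shows "priestley_space closure_of S = prime_filters \<longleftrightarrow>
    (\<forall>a b. \<not> a \<le> b \<longrightarrow> (\<exists>x\<in>S. a \<in> x \<and> b \<notin> x))"
proof
  assume "priestley_space closure_of S = prime_filters"
  then have dense: "\<And>T. openin priestley_space T \<Longrightarrow> T \<noteq> {} \<Longrightarrow> S \<inter> T \<noteq> {}"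
    using dense_intersects_open[of priestley_space S] by auto
  show "\<forall>a b. \<not> a \<le> b \<longrightarrow> (\<exists>x\<in>S. a \<in> x \<and> b \<notin> x)"
  proof (intro allI impI)
    fix a b :: 'a assume "\<not> a \<le> b"
    then obtain x where "x \<in> sigma_set a - sigma_set b"
      using prime_filter_separates unfolding sigma_set_def by blast
    then show "\<exists>x\<in>S. a \<in> x \<and> b \<notin> x"
      using dense[OF openin_basic, of a b] unfolding sigma_set_def by blast
  qed
next
  assume sep: "\<forall>a b. \<not> a \<le> b \<longrightarrow> (\<exists>x\<in>S. a \<in> x \<and> b \<notin> x)"
  have "S \<inter> T \<noteq> {}" if T: "openin priestley_space T" and "T \<noteq> {}" for T
  proof -
    obtain y where "y \<in> T" using \<open>T \<noteq> {}\<close> by blast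
    then obtain a b where ab: "y \<in> sigma_set a - sigma_set b" "sigma_set a - sigma_set b \<subseteq> T"
      using openin_contains_basic[OF T] by blast
    then have "y \<in> prime_filters" "a \<in> y" "b \<notin> y" unfolding sigma_set_def by auto
    then have "\<not> a \<le> b" using prime_filtersD(1) lattice_filter_mono by blast
    then obtain x where "x \<in> S" "a \<in> x" "b \<notin> x" using sep by blast
    then show ?thesis using ab(2) assms unfolding sigma_set_def by blast
  qed
  then show "priestley_space closure_of S = prime_filters"
    using dense_intersects_open[of priestley_space S] by auto
qed

lemma min_elements_subset: "min_elements S \<subseteq> S"
  unfolding min_elements_def by blast

lemma subfit_iff_min_dense:
  "subfit TYPE('a::frame) \<longleftrightarrow>
     priestley_space closure_of (min_elements prime_filters) = (prime_filters :: 'a set set)"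
  unfolding dense_iff_separates[OF min_elements_subset]
proof
  assume sf: "subfit TYPE('a)"
  show "\<forall>a b :: 'a. \<not> a \<le> b \<longrightarrow> (\<exists>x\<in>min_elements prime_filters. a \<in> x \<and> b \<notin> x)"
  proof (intro allI impI)
    fix a b :: 'a assume "\<not> a \<le> b"
    then obtain c where c: "sup a c = top" "sup b c \<noteq> top"
      using sf unfolding subfit_def by blast
    \<comment> \<open>Omitting \<open>sup b c\<close> means omitting \<open>b\<close> and \<open>c\<close>; primeness and \<open>sup a c = top\<close> then force \<open>a\<close>.\<close>
    obtain x where x: "x \<in> min_elements prime_filters" "sup b c \<notin> x"
      using minimal_prime_omitting[OF c(2)] .
    then have xp: "x \<in> prime_filters" using min_elements_subset by blast
    note xF = prime_filtersD(1)[OF xp]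
    have "b \<notin> x" "c \<notin> x" using x(2) lattice_filter_mono[OF xF] by auto
    moreover have "sup a c \<in> x" using c(1) lattice_filter_top[OF xF] by simp
    ultimately have "a \<in> x" using lattice_ideal_sup[OF prime_filtersD(2)[OF xp]] by blast
    then show "\<exists>x\<in>min_elements prime_filters. a \<in> x \<and> b \<notin> x"
      using x(1) \<open>b \<notin> x\<close> by blast
  qed
next
  assume sep: "\<forall>a b :: 'a. \<not> a \<le> b \<longrightarrow> (\<exists>x\<in>min_elements prime_filters. a \<in> x \<and> b \<notin> x)"
  show "subfit TYPE('a)"
    unfolding subfit_def
  proof (intro allI impI)
    fix a b :: 'a assume "\<not> a \<le> b"
    then obtain x where x: "x \<in> min_elements prime_filters" "a \<in> x" "b \<notin> x" using sep by blast
    then have xp: "x \<in> prime_filters" using min_elements_subset by blast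
    obtain d where d: "d \<notin> x" "sup a d = top" using minimal_prime_cover[OF x(1,2)] .
    have "sup b d \<notin> x" using lattice_ideal_sup[OF prime_filtersD(2)[OF xp]] x(3) d(1) by blast
    then have "sup b d \<noteq> top" using lattice_filter_top[OF prime_filtersD(1)[OF xp]] by auto
    then show "\<exists>c. sup a c = top \<and> sup b c \<noteq> top" using d(2) by blast
  qed
qed

text \<open>
  With \<open>D\<close> the minimal prime filters, this applies to both \<open>S = min_elements U\<close> and \<open>S = sfit U\<close>.
\<close>

lemma dense_in_clopen:
  assumes dense: "priestley_space closure_of D = prime_filters"
    and U: "U \<in> clopen_sets" and S: "D \<inter> U \<subseteq> S" "S \<subseteq> U"
  shows "priestley_space closure_of S = U"
proof
  show "priestley_space closure_of S \<subseteq> U"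
    using U S(2) by (simp add: clopen_sets_def closure_of_minimal)
  have op: "openin priestley_space U" using U by (simp add: clopen_sets_def)
  have "U \<subseteq> U \<inter> priestley_space closure_of D"
    using openin_subset[OF op] dense by simp
  also have "\<dots> \<subseteq> priestley_space closure_of (U \<inter> D)"
    by (rule openin_Int_closure_of_subset[OF op])
  also have "\<dots> \<subseteq> priestley_space closure_of S"
    using S(1) by (intro closure_of_mono) blast
  finally show "U \<subseteq> priestley_space closure_of S" .
qed

lemma clop_upD:
  assumes "U \<in> clop_up"
  shows "U \<in> clopen_sets" "U \<subseteq> prime_filters"
  using assms openin_subset[of priestley_space U] unfolding clop_up_def clopen_sets_def by auto

lemma clop_up_sigma_set: "sigma_set a \<in> clop_up"
  unfolding clop_up_def using clopen_sigma_set by (auto simp: sigma_set_def)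

lemma min_elements_Int_subset:
  assumes "U \<subseteq> X"
  shows "min_elements X \<inter> U \<subseteq> min_elements U"
  using assms unfolding min_elements_def by blast

lemma min_elements_Int_subset_sfit: "min_elements prime_filters \<inter> U \<subseteq> sfit U"
  unfolding min_elements_def sfit_def down_def by blast

lemma min_dense_iff_min_clop_up:
  "priestley_space closure_of (min_elements prime_filters) = (prime_filters :: 'a::frame set set)
   \<longleftrightarrow> (\<forall>U\<in>(clop_up :: 'a set set set). priestley_space closure_of (min_elements U) = U)"
proof
  assume dense: "priestley_space closure_of (min_elements prime_filters) = (prime_filters :: 'a set set)"
  show "\<forall>U\<in>(clop_up :: 'a set set set). priestley_space closure_of (min_elements U) = U"
    using dense_in_clopen[OF dense] clop_upD min_elements_Int_subset min_elements_subset by metis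
next
  assume "\<forall>U\<in>(clop_up :: 'a set set set). priestley_space closure_of (min_elements U) = U"
  then show "priestley_space closure_of (min_elements prime_filters) = (prime_filters :: 'a set set)"
    using clop_up_sigma_set[of "top :: 'a"] by (simp add: sigma_set_top)
qed

text \<open>
  For the converse, density of \<open>sfit (sigma_set a)\<close> in \<open>sigma_set a\<close> gives a prime filter \<open>y\<close> in the
  kernel omitting \<open>b\<close>. Any minimal prime filter below \<open>y\<close> omits \<open>b\<close> because it is smaller, and
  contains \<open>a\<close> because the whole principal downset of \<open>y\<close> lies in \<open>sigma_set a\<close>.
\<close>

lemma min_dense_iff_sfit:
  "priestley_space closure_of (min_elements prime_filters) = (prime_filters :: 'a::frame set set)
   \<longleftrightarrow> (\<forall>U\<in>(clop_up :: 'a set set set). priestley_space closure_of (sfit U) = U)"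
proof
  assume dense: "priestley_space closure_of (min_elements prime_filters) = (prime_filters :: 'a set set)"
  have "sfit U \<subseteq> U" for U :: "'a set set" unfolding sfit_def by blast
  then show "\<forall>U\<in>(clop_up :: 'a set set set). priestley_space closure_of (sfit U) = U"
    using dense_in_clopen[OF dense] clop_upD(1) min_elements_Int_subset_sfit by metis
next
  assume sfit: "\<forall>U\<in>(clop_up :: 'a set set set). priestley_space closure_of (sfit U) = U"
  show "priestley_space closure_of (min_elements prime_filters) = (prime_filters :: 'a set set)"
    unfolding dense_iff_separates[OF min_elements_subset]
  proof (intro allI impI)
    fix a b :: 'a assume "\<not> a \<le> b"
    then obtain x where x: "x \<in> sigma_set a - sigma_set b"
      using prime_filter_separates unfolding sigma_set_def by blast
    then have "x \<in> priestley_space closure_of (sfit (sigma_set a))"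
      using sfit clop_up_sigma_set by auto
    then obtain y where y: "y \<in> sfit (sigma_set a)" "y \<in> sigma_set a - sigma_set b"
      using x openin_basic[of a b] unfolding in_closure_of by blast
    then have yp: "y \<in> prime_filters" "b \<notin> y" unfolding sigma_set_def by auto
    obtain z where z: "z \<in> min_elements prime_filters" "z \<subseteq> y"
      using minimal_prime_below_prime[OF yp(1)] .
    then have "z \<in> down {y}" using min_elements_subset unfolding down_def by blast
    then have "a \<in> z" using y(1) unfolding sfit_def sigma_set_def by blast
    then show "\<exists>x\<in>min_elements prime_filters. a \<in> x \<and> b \<notin> x"
      using z yp(2) by blast
  qed
qed

text \<open>
  For the converse, a nonempty basic set missed by the minimal prime filters is removed from the
  whole space. What remains is proper and clopen, hence nuclear, and contains them all.
\<close>

lemma min_dense_iff_nuclear: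
  "priestley_space closure_of (min_elements prime_filters) = (prime_filters :: 'a::frame set set)
   \<longleftrightarrow> (\<forall>N :: 'a set set. nuclear_subset N \<longrightarrow> min_elements prime_filters \<subseteq> N \<longrightarrow> N = prime_filters)"
proof
  assume dense: "priestley_space closure_of (min_elements prime_filters) = (prime_filters :: 'a set set)"
  show "\<forall>N :: 'a set set. nuclear_subset N \<longrightarrow> min_elements prime_filters \<subseteq> N \<longrightarrow> N = prime_filters"
  proof (intro allI impI)
    fix N :: "'a set set" assume "nuclear_subset N" and sub: "min_elements prime_filters \<subseteq> N"
    then have cl: "closedin priestley_space N" unfolding nuclear_subset_def by simp
    show "N = prime_filters"
      using closure_of_minimal[OF sub cl] dense closedin_subset[OF cl] by simp
  qed
next
  assume nuc: "\<forall>N :: 'a set set. nuclear_subset N \<longrightarrow> min_elements prime_filters \<subseteq> N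
    \<longrightarrow> N = prime_filters"
  show "priestley_space closure_of (min_elements prime_filters) = (prime_filters :: 'a set set)"
    unfolding dense_iff_separates[OF min_elements_subset]
  proof (intro allI impI, rule ccontr)
    fix a b :: 'a assume "\<not> a \<le> b"
    then obtain x where x: "x \<in> prime_filters" "x \<in> sigma_set a - sigma_set b"
      using prime_filter_separates unfolding sigma_set_def by blast
    let ?N = "prime_filters - (sigma_set a - sigma_set b)"
    assume "\<not> (\<exists>x\<in>min_elements prime_filters. a \<in> x \<and> b \<notin> x)"
    then have "min_elements prime_filters \<subseteq> ?N"
      using min_elements_subset unfolding sigma_set_def by blast
    moreover have "nuclear_subset ?N"
      by (intro clopen_nuclear clopen_Diff clopen_prime_filters clopen_basic)
    ultimately have "?N = prime_filters" using nuc by blast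
    then show False using x by blast
  qed
qed

theorem theorem5p4:
  shows "(subfit TYPE('a::frame) \<longleftrightarrow>
            (\<forall>U\<in>(clop_up :: 'a set set set). priestley_space closure_of (min_elements U) = U))
       \<and> (subfit TYPE('a) \<longleftrightarrow>
            priestley_space closure_of (min_elements prime_filters) = (prime_filters :: 'a set set))
       \<and> (subfit TYPE('a) \<longleftrightarrow>
            (\<forall>N :: 'a set set. nuclear_subset N \<longrightarrow> min_elements prime_filters \<subseteq> N
                \<longrightarrow> N = prime_filters))
       \<and> (subfit TYPE('a) \<longleftrightarrow>
            (\<forall>U\<in>(clop_up :: 'a set set set). priestley_space closure_of (sfit U) = U))"
  unfolding subfit_iff_min_dense
  by (intro conjI refl min_dense_iff_min_clop_up min_dense_iff_nuclear min_dense_iff_sfit)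

end
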